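(* Let $(w_u)_{u\in W}$ be a summable family of positive reals on a countable set $W$, let $\pi:W\to Z$ be any map, and for each $z$ in the image of $\pi$ let $w_{z,1}\ge w_{z,2}\ge\cdots$ be the weights in the fibre $\pi^{-1}(z)$ arranged in nonincreasing order. Fix an integer $g\ge1$ and $\alpha>0$ with $\alpha\ne1$, put $d_\alpha=\lvert2-2^\alpha\rvert$, assume $\sum_uw_u^\alpha<\infty$, and set $$T_{\alpha,g}(\pi):=\sum_z\sum_{j>g}w_{z,j}^{\,\alpha}.$$ Then for every labelling $\lambda:W\to\{1,\dots,g\}$, $$\Bigl\lvert\sum_{u\in W}w_u^\alpha-\sum_{(z,c)}\Bigl(\sum_{u:\,\pi(u)=z,\ \lambda(u)=c}w_u\Bigr)^{\alpha}\Bigr\rvert\ \ge\ d_\alpha\,T_{\alpha,g}(\pi).$$ For every $g\ge1$ the constant $d_\alpha$ is optimal, i.e. it cannot be replaced by any larger constant in this inequality. For $g=1$ equality holds if and only if every nonsingleton fibre of $\pi$ consists of exactly two elements of equal weight.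
   Context: The sum over $(z,c)$ runs over $z$ in the image of $\pi$ and $c\in\{1,\dots,g\}$; empty classes contribute $0$. In the inner sum defining $T_{\alpha,g}(\pi)$, $j$ ranges over indices $j>g$ for which $w_{z,j}$ exists (a fibre with at most $g$ elements contributes $0$). *)

theory Defs
  imports "HOL-Analysis.Analysis"
begin

text \<open>
  Infinite sums are unconditional sums over sets (\<^const>\<open>infsum\<close>), which default to 0 when
  the family is not summable. For an admissible family every sum below is summable, so this
  default is never used.
\<close>

definition admissible_family :: "real \<Rightarrow> 'w set \<Rightarrow> ('w \<Rightarrow> real) \<Rightarrow> bool" where
  "admissible_family \<alpha> W w \<longleftrightarrow>
     countable W \<and> (\<forall>u\<in>W. w u > 0) \<and> w summable_on W \<and> (\<lambda>u. w u powr \<alpha>) summable_on W"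

definition fibre :: "'w set \<Rightarrow> ('w \<Rightarrow> 'z) \<Rightarrow> 'z \<Rightarrow> 'w set" where
  "fibre W \<pi> z = {u \<in> W. \<pi> u = z}"

text \<open>
  Ranks start at 1; a finite fibre has ranks \<open>1, \<dots>, card F\<close>, an infinite one has all
  positive ranks.
\<close>

definition ranks :: "'w set \<Rightarrow> nat set" where
  "ranks F = {j. 1 \<le> j \<and> (finite F \<longrightarrow> j \<le> card F)}"

definition nonincreasing_arrangement :: "('w \<Rightarrow> real) \<Rightarrow> 'w set \<Rightarrow> (nat \<Rightarrow> 'w) \<Rightarrow> bool" where
  "nonincreasing_arrangement w F e \<longleftrightarrow>
     bij_betw e (ranks F) F \<and>
     (\<forall>i\<in>ranks F. \<forall>j\<in>ranks F. i \<le> j \<longrightarrow> w (e j) \<le> w (e i))"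

text \<open>
  The choice below is between arrangements that differ only by permuting elements of equal
  weight, so the weight at a given rank does not depend on it. An arrangement exists for every
  countable \<open>F\<close> with positive summable weights, since only finitely many weights exceed
  any given positive bound.
\<close>

definition ordered_weight :: "('w \<Rightarrow> real) \<Rightarrow> 'w set \<Rightarrow> nat \<Rightarrow> real" where
  "ordered_weight w F j = w ((SOME e. nonincreasing_arrangement w F e) j)"

definition tail_sum :: "real \<Rightarrow> nat \<Rightarrow> 'w set \<Rightarrow> ('w \<Rightarrow> real) \<Rightarrow> ('w \<Rightarrow> 'z) \<Rightarrow> real" where
  "tail_sum \<alpha> g W w \<pi> =
     (\<Sum>\<^sub>\<infinity>z\<in>\<pi> ` W. \<Sum>\<^sub>\<infinity>j\<in>{j \<in> ranks (fibre W \<pi> z). j > g}.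
        ordered_weight w (fibre W \<pi> z) j powr \<alpha>)"

text \<open>Empty classes contribute \<open>0 powr \<alpha> = 0\<close>.\<close>

definition merging_defect ::
  "real \<Rightarrow> nat \<Rightarrow> 'w set \<Rightarrow> ('w \<Rightarrow> real) \<Rightarrow> ('w \<Rightarrow> 'z) \<Rightarrow> ('w \<Rightarrow> nat) \<Rightarrow> real" where
  "merging_defect \<alpha> g W w \<pi> lab =
     \<bar>(\<Sum>\<^sub>\<infinity>u\<in>W. w u powr \<alpha>) -
      (\<Sum>\<^sub>\<infinity>(z, c)\<in>(\<pi> ` W) \<times> {1..g}.
         (\<Sum>\<^sub>\<infinity>u\<in>{u \<in> W. \<pi> u = z \<and> lab u = c}. w u) powr \<alpha>)\<bar>"

definition d_const :: "real \<Rightarrow> real" where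
  "d_const \<alpha> = \<bar>2 - 2 powr \<alpha>\<bar>"

end

theory Submission
  imports Defs
begin

text \<open>
  For \<open>x \<ge> y > 0\<close> the quantity \<open>\<bar>x\<^sup>\<alpha> + y\<^sup>\<alpha> - (x + y)\<^sup>\<alpha>\<bar>\<close> is strictly increasing in \<open>x\<close>, so it
  is at least its value \<open>d\<^sub>\<alpha> y\<^sup>\<alpha>\<close> at \<open>x = y\<close>. Starting a class from its heaviest element and merging
  the others one at a time, each new element is at most the weight merged so far, and so costs at
  least \<open>d\<^sub>\<alpha>\<close> times its own \<open>\<alpha>\<close>-th power; all costs have the same sign. Equality forces the second
  element to tie with the heaviest one and excludes a third. Inside a fibre the
  heaviest elements of the classes are at most \<open>g\<close> in number, and what remains after removing at most
  \<open>g\<close> elements weighs least when the \<open>g\<close> heaviest are removed, which gives the tail sum. The constant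
  is attained by one fibre of \<open>g + 1\<close> equal weights in which exactly two elements share a label.
\<close>

section \<open>The two-point inequality and its equality case\<close>

lemma two_point_eq:
  fixes \<alpha> y :: real
  assumes "\<alpha> \<noteq> 1" "y > 0"
  shows "sgn (1 - \<alpha>) * (y powr \<alpha> + y powr \<alpha> - (y + y) powr \<alpha>) = d_const \<alpha> * y powr \<alpha>"
proof -
  have dbl: "(y + y) powr \<alpha> = 2 powr \<alpha> * y powr \<alpha>"
    using powr_mult[of 2 y \<alpha>] \<open>y > 0\<close> by simp
  have "sgn (1 - \<alpha>) * (2 - 2 powr \<alpha>) = d_const \<alpha>"
  proof (cases "\<alpha> < 1")
    case True
    then have "2 powr \<alpha> < (2::real)"
      using powr_less_mono[of \<alpha> 1 "2::real"] by simp
    with True show ?thesis by (simp add: d_const_def)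
  next
    case False
    then have "\<alpha> > 1" using \<open>\<alpha> \<noteq> 1\<close> by simp
    then have "2 powr \<alpha> > (2::real)"
      using powr_less_mono[of 1 \<alpha> "2::real"] by simp
    with \<open>\<alpha> > 1\<close> show ?thesis by (simp add: d_const_def)
  qed
  then show ?thesis
    unfolding dbl by (metis (no_types, lifting) left_diff_distrib mult.assoc mult_2)
qed

text \<open>With \<open>y\<close> fixed, the right-hand side is strictly increasing in
  \<open>x\<close> on \<open>x \<ge> y\<close>, and \<open>two_point_eq\<close> gives its value at
  \<open>x = y\<close>.\<close>

lemma two_point_less:
  fixes \<alpha> x y :: real
  assumes "\<alpha> > 0" "\<alpha> \<noteq> 1" "0 < y" "y < x"
  shows "d_const \<alpha> * y powr \<alpha> < sgn (1 - \<alpha>) * (x powr \<alpha> + y powr \<alpha> - (x + y) powr \<alpha>)"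
proof -
  \<comment> \<open>The part of the signed defect that depends on \<open>x\<close>; the constant
    term \<open>y powr \<alpha>\<close> is left out.\<close>
  define h where "h t = sgn (1 - \<alpha>) * (t powr \<alpha> - (t + y) powr \<alpha>)" for t
  have "h y < h x"
  proof (rule DERIV_pos_imp_increasing[OF \<open>y < x\<close>])
    fix t assume "y \<le> t"
    then have "t > 0" using \<open>0 < y\<close> by simp
    have "(h has_real_derivative
        sgn (1 - \<alpha>) * (\<alpha> * t powr (\<alpha> - 1) - \<alpha> * (t + y) powr (\<alpha> - 1))) (at t)"
      unfolding h_def using \<open>t > 0\<close> \<open>0 < y\<close>
      by (auto intro!: derivative_eq_intros)
    \<comment> \<open>The power with exponent \<open>\<alpha> - 1\<close> decreases for
      \<open>\<alpha> < 1\<close> and increases for \<open>\<alpha> > 1\<close>; the sign factor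
      absorbs the change.\<close>
    moreover have "0 < sgn (1 - \<alpha>) * (t powr (\<alpha> - 1) - (t + y) powr (\<alpha> - 1))"
    proof (cases "\<alpha> < 1")
      case True
      then show ?thesis
        using powr_less_mono2_neg[of "\<alpha> - 1" t "t + y"] \<open>t > 0\<close> \<open>0 < y\<close> by simp
    next
      case False
      then show ?thesis
        using powr_less_mono2[of "\<alpha> - 1" t "t + y"] \<open>\<alpha> \<noteq> 1\<close> \<open>t > 0\<close> \<open>0 < y\<close> by simp
    qed
    then have "0 < \<alpha> * (sgn (1 - \<alpha>) * (t powr (\<alpha> - 1) - (t + y) powr (\<alpha> - 1)))"
      using \<open>\<alpha> > 0\<close> by simp
    then have "0 < sgn (1 - \<alpha>) * (\<alpha> * t powr (\<alpha> - 1) - \<alpha> * (t + y) powr (\<alpha> - 1))"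
      by (simp add: algebra_simps)
    ultimately show "\<exists>D. DERIV h t :> D \<and> D > 0" by blast
  qed
  then show ?thesis
    using two_point_eq[OF \<open>\<alpha> \<noteq> 1\<close> \<open>0 < y\<close>] by (simp add: h_def algebra_simps)
qed

lemma two_point_le:
  fixes \<alpha> x y :: real
  assumes "\<alpha> > 0" "\<alpha> \<noteq> 1" "0 < y" "y \<le> x"
  shows "d_const \<alpha> * y powr \<alpha> \<le> sgn (1 - \<alpha>) * (x powr \<alpha> + y powr \<alpha> - (x + y) powr \<alpha>)"
  using two_point_less[OF assms(1-3)] two_point_eq[OF assms(2,3)] \<open>y \<le> x\<close>
  by (cases "y = x") (fastforce simp: less_eq_real_def)+

section \<open>Infinite sums, heaviest elements and regrouping\<close>

lemma has_sum_diff: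
  fixes f g :: "'a \<Rightarrow> 'b::topological_ab_group_add"
  assumes "(f has_sum a) A" "(g has_sum b) A"
  shows "((\<lambda>x. f x - g x) has_sum (a - b)) A"
  using has_sum_add[OF assms(1), of "\<lambda>x. - g x" "- b"] assms(2) by (simp add: has_sum_uminus)

text \<open>Any \<open>n\<close> elements of weight at least \<open>c\<close> sum to at least
  \<open>n * c\<close>, which exceeds the total for large \<open>n\<close>.\<close>

lemma finite_weight_ge:
  fixes w :: "'a \<Rightarrow> real"
  assumes "w summable_on A" "c > 0" "\<And>u. u \<in> A \<Longrightarrow> w u \<ge> 0"
  shows "finite {u \<in> A. c \<le> w u}"
proof (rule ccontr)
  let ?B = "{u \<in> A. c \<le> w u}"
  assume inf: "infinite ?B"
  obtain n :: nat where n: "infsum w A < real n * c"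
    using ex_less_of_nat_mult[OF \<open>c > 0\<close>] by blast
  obtain X where X: "X \<subseteq> ?B" "finite X" "card X = n"
    using infinite_arbitrarily_large[OF inf] by metis
  have "real n * c \<le> sum w X"
    using sum_bounded_below[of X c w] X by auto
  also have "\<dots> \<le> infsum w A"
    using X assms(3) by (intro finite_sum_le_infsum assms(1)) auto
  finally show False using n by simp
qed

text \<open>Only finitely many elements weigh at least as much as a chosen \<open>a\<close>, so a
  maximum over these is a maximum over all of \<open>A\<close>.\<close>

lemma exists_heaviest:
  fixes w :: "'a \<Rightarrow> real"
  assumes "w summable_on A" "\<And>u. u \<in> A \<Longrightarrow> w u > 0" "A \<noteq> {}"
  shows "\<exists>m\<in>A. \<forall>u\<in>A. w u \<le> w m"
proof -
  obtain a where a: "a \<in> A" using assms(3) by blast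
  let ?B = "{u \<in> A. w a \<le> w u}"
  have fin: "finite ?B" 
    using assms(1) assms(2)[OF a] assms(2) by (intro finite_weight_ge) (auto simp: less_imp_le)
  have ne: "?B \<noteq> {}" using a by auto
  have "Max (w ` ?B) \<in> w ` ?B" using fin ne by (intro Max_in) auto
  then obtain m where m: "m \<in> ?B" "w m = Max (w ` ?B)" by force
  show ?thesis
  proof (intro bexI[of _ m] ballI)
    show "m \<in> A" using m(1) by simp
    fix u assume "u \<in> A"
    show "w u \<le> w m"
    proof (cases "w a \<le> w u")
      case True
      then show ?thesis unfolding m(2) using \<open>u \<in> A\<close> fin by (intro Max_ge) auto
    next
      case False
      then show ?thesis using m(1) by simp
    qed
  qed
qed

text \<open>Pairing each element with its index turns the sum over \<open>W\<close> into a sum over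
  a disjoint union, to which the iterated-sum theorem applies. Indices of \<open>I\<close> outside
  the image have empty classes.\<close>

lemma infsum_fibres:
  fixes f :: "'a \<Rightarrow> real"
  assumes "f summable_on W" "\<kappa> ` W \<subseteq> I"
  shows "(\<lambda>i. \<Sum>\<^sub>\<infinity>u\<in>{u \<in> W. \<kappa> u = i}. f u) summable_on I"
    and "(\<Sum>\<^sub>\<infinity>i\<in>I. \<Sum>\<^sub>\<infinity>u\<in>{u \<in> W. \<kappa> u = i}. f u) = (\<Sum>\<^sub>\<infinity>u\<in>W. f u)"
proof -
  let ?K = "\<lambda>i. {u \<in> W. \<kappa> u = i}"
  have bij: "bij_betw snd (Sigma I ?K) W"
    using assms(2) by (force simp: bij_betw_def inj_on_def)
  have sm: "(\<lambda>(i, u). f u) summable_on Sigma I ?K"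
    using summable_on_reindex_bij_betw[OF bij, of f] assms(1) by (simp add: case_prod_unfold)
  show "(\<lambda>i. \<Sum>\<^sub>\<infinity>u\<in>?K i. f u) summable_on I"
    using summable_on_Sigma_banach[OF sm] by simp
  show "(\<Sum>\<^sub>\<infinity>i\<in>I. \<Sum>\<^sub>\<infinity>u\<in>?K i. f u) = (\<Sum>\<^sub>\<infinity>u\<in>W. f u)"
    using infsum_Sigma'_banach[OF sm] infsum_reindex_bij_betw[OF bij, of f]
    by (simp add: case_prod_unfold)
qed

section \<open>The excess of a single class\<close>

text \<open>
  \<open>m\<close> stands for a heaviest element of \<open>A\<close>; the subtracted term is then
  \<open>d\<^sub>\<alpha>\<close> times the sum over the other elements. The factor \<open>sgn (1 - \<alpha>)\<close> makes the
  merging defect of a single class nonnegative on both sides of \<open>\<alpha> = 1\<close>.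
\<close>

definition excess :: "real \<Rightarrow> ('a \<Rightarrow> real) \<Rightarrow> 'a \<Rightarrow> 'a set \<Rightarrow> real" where
  "excess \<alpha> w m A =
     sgn (1 - \<alpha>) * ((\<Sum>\<^sub>\<infinity>u\<in>A. w u powr \<alpha>) - (\<Sum>\<^sub>\<infinity>u\<in>A. w u) powr \<alpha>)
       - d_const \<alpha> * ((\<Sum>\<^sub>\<infinity>u\<in>A. w u powr \<alpha>) - w m powr \<alpha>)"

lemma excess_singleton:
  assumes "w m > 0"
  shows "excess \<alpha> w m {m} = 0"
  using assms by (simp add: excess_def)

text \<open>The increment is the gap in the two-point inequality for the pair
  \<open>sum w F\<close>, \<open>w y\<close>, so its sign is known once
  \<open>w y \<le> sum w F\<close>.\<close>

lemma excess_insert: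
  fixes w :: "'a \<Rightarrow> real"
  assumes "finite F" "y \<notin> F"
  shows "excess \<alpha> w m (insert y F) = excess \<alpha> w m F
    + (sgn (1 - \<alpha>) * (sum w F powr \<alpha> + w y powr \<alpha> - (sum w F + w y) powr \<alpha>)
       - d_const \<alpha> * w y powr \<alpha>)"
  using assms by (simp add: excess_def algebra_simps)

lemma excess_le_insert:
  fixes w :: "'a \<Rightarrow> real"
  assumes "\<alpha> > 0" "\<alpha> \<noteq> 1" "finite F" "m \<in> F" "\<And>u. u \<in> insert y F \<Longrightarrow> w u > 0" "w y \<le> w m"
  shows "excess \<alpha> w m F \<le> excess \<alpha> w m (insert y F)"
proof (cases "y \<in> F")
  case True
  then show ?thesis by (simp add: insert_absorb)
next
  case False
  \<comment> \<open>Since \<open>m\<close> is merged from the start, the accumulated weight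
    dominates every later element.\<close>
  have "w m \<le> sum w F" using assms(3-5) by (intro member_le_sum) (auto simp: less_imp_le)
  then show ?thesis
    using two_point_le[OF assms(1,2), of "w y" "sum w F"] assms(5)[of y] assms(6)
    by (simp add: excess_insert[OF assms(3) False])
qed

lemma excess_mono_finite:
  fixes w :: "'a \<Rightarrow> real"
  assumes "\<alpha> > 0" "\<alpha> \<noteq> 1" "finite G" "F \<subseteq> G" "m \<in> F"
    and "\<And>u. u \<in> G \<Longrightarrow> 0 < w u \<and> w u \<le> w m"
  shows "excess \<alpha> w m F \<le> excess \<alpha> w m G"
proof -
  have "finite F" using assms(3,4) by (rule finite_subset[rotated])
  have "excess \<alpha> w m F \<le> excess \<alpha> w m (F \<union> B)" if "finite B" "B \<subseteq> G" for B
    using that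
  proof (induction B rule: finite_induct)
    case (insert y B)
    have "excess \<alpha> w m (F \<union> B) \<le> excess \<alpha> w m (insert y (F \<union> B))"
      by (rule excess_le_insert) (use insert assms \<open>finite F\<close> in auto)
    with insert show ?case by simp
  qed simp
  from this[of G] show ?thesis using assms(3,4) by (simp add: Un_absorb1)
qed

text \<open>Finite subsets of \<open>A\<close> that contain \<open>F\<close> have excess at least
  that of \<open>F\<close>; the bound survives the limit along finite subsets, which covers infinite
  classes.\<close>

lemma excess_mono:
  fixes w :: "'a \<Rightarrow> real"
  assumes "\<alpha> > 0" "\<alpha> \<noteq> 1" "finite F" "F \<subseteq> A" "m \<in> F"
    and pos: "\<And>u. u \<in> A \<Longrightarrow> 0 < w u" and max: "\<And>u. u \<in> A \<Longrightarrow> w u \<le> w m"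
    and sm: "w summable_on A" and sma: "(\<lambda>u. w u powr \<alpha>) summable_on A"
  shows "excess \<alpha> w m F \<le> excess \<alpha> w m A"
proof (rule tendsto_lowerbound)
  let ?L = "finite_subsets_at_top A"
  have 1: "(sum w \<longlongrightarrow> infsum w A) ?L"
    using has_sum_infsum[OF sm] by (simp add: has_sum_def)
  have 2: "(sum (\<lambda>u. w u powr \<alpha>) \<longlongrightarrow> (\<Sum>\<^sub>\<infinity>u\<in>A. w u powr \<alpha>)) ?L"
    using has_sum_infsum[OF sma] by (simp add: has_sum_def)
  have "w m \<le> infsum w A"
    using finite_sum_le_infsum[OF sm, of "{m}"] assms(4,5) pos by (auto simp: less_imp_le)
  \<comment> \<open>The limit of the base is nonzero, the side condition under which
    \<open>powr\<close> passes to the limit.\<close>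
  then have nz: "infsum w A \<noteq> 0" using pos[of m] assms(4,5) by auto
  have "((\<lambda>X. sgn (1 - \<alpha>) * (sum (\<lambda>u. w u powr \<alpha>) X - sum w X powr \<alpha>)
       - d_const \<alpha> * (sum (\<lambda>u. w u powr \<alpha>) X - w m powr \<alpha>)) \<longlongrightarrow> excess \<alpha> w m A) ?L"
    unfolding excess_def by (intro tendsto_intros 1 2 disjI1 nz)
  then show "(excess \<alpha> w m \<longlongrightarrow> excess \<alpha> w m A) ?L"
    by (rule Lim_transform_eventually)
      (auto simp: excess_def eventually_finite_subsets_at_top intro!: exI[of _ "{}"])
  show "\<forall>\<^sub>F X in ?L. excess \<alpha> w m F \<le> excess \<alpha> w m X"
    unfolding eventually_finite_subsets_at_top
    by (rule exI[of _ F]) (use assms in \<open>auto intro!: excess_mono_finite\<close>)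
qed simp

lemma excess_nonneg:
  fixes w :: "'a \<Rightarrow> real"
  assumes "\<alpha> > 0" "\<alpha> \<noteq> 1" "m \<in> A"
    and "\<And>u. u \<in> A \<Longrightarrow> 0 < w u" "\<And>u. u \<in> A \<Longrightarrow> w u \<le> w m"
    and "w summable_on A" "(\<lambda>u. w u powr \<alpha>) summable_on A"
  shows "0 \<le> excess \<alpha> w m A"
  using excess_mono[of \<alpha> "{m}" A m w] excess_singleton[of w m \<alpha>] assms by simp

text \<open>By monotonicity, a finite subset containing \<open>m\<close> with positive excess rules
  out equality. Subsets of two and three elements suffice.\<close>

lemma excess_eq_0_iff:
  fixes w :: "'a \<Rightarrow> real"
  assumes "\<alpha> > 0" "\<alpha> \<noteq> 1" "m \<in> A"
    and pos: "\<And>u. u \<in> A \<Longrightarrow> 0 < w u" and max: "\<And>u. u \<in> A \<Longrightarrow> w u \<le> w m"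
    and "w summable_on A" "(\<lambda>u. w u powr \<alpha>) summable_on A"
  shows "excess \<alpha> w m A = 0 \<longleftrightarrow> A = {m} \<or> (\<exists>v. v \<noteq> m \<and> A = {m, v} \<and> w v = w m)"
proof
  have "w m > 0" using assms by blast
  have pair: "excess \<alpha> w m {m, v} = sgn (1 - \<alpha>) * (w m powr \<alpha> + w v powr \<alpha> - (w m + w v) powr \<alpha>)
       - d_const \<alpha> * w v powr \<alpha>" if "v \<noteq> m" for v
    using excess_insert[of "{m}" v \<alpha> w m] that excess_singleton[of w m \<alpha>] \<open>w m > 0\<close>
    by (simp add: insert_commute)
  have mono: "excess \<alpha> w m F \<le> excess \<alpha> w m A" if "finite F" "m \<in> F" "F \<subseteq> A" for F
    using that assms by (intro excess_mono) auto
  show "excess \<alpha> w m A = 0" if "A = {m} \<or> (\<exists>v. v \<noteq> m \<and> A = {m, v} \<and> w v = w m)"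
    using that
  proof (elim disjE exE conjE)
    assume "A = {m}"
    then show ?thesis using excess_singleton \<open>w m > 0\<close> by metis
  next
    fix v assume "v \<noteq> m" "A = {m, v}" "w v = w m"
    then show ?thesis using pair[of v] two_point_eq[OF assms(2) \<open>w m > 0\<close>] by simp
  qed
  assume zero: "excess \<alpha> w m A = 0"
  show "A = {m} \<or> (\<exists>v. v \<noteq> m \<and> A = {m, v} \<and> w v = w m)"
  proof (cases "A = {m}")
    case False
    then obtain v where v: "v \<in> A" "v \<noteq> m" using assms(3) by blast
    have eq: "w v = w m"
    proof (rule ccontr)
      assume "w v \<noteq> w m"
      then have "w v < w m" using max[OF v(1)] by simp
      then have "0 < excess \<alpha> w m {m, v}"
        using pair[OF v(2)] two_point_less[OF assms(1,2) pos[OF v(1)]] by simp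
      then show False using mono[of "{m, v}"] v assms(3) zero by simp
    qed
    have "A = {m, v}"
    proof (rule ccontr)
      assume "A \<noteq> {m, v}"
      then obtain t where t: "t \<in> A" "t \<noteq> m" "t \<noteq> v" using v assms(3) by blast
      \<comment> \<open>Two merged weights strictly exceed any third one, even when all three are
        equal, so the third increment is strictly positive.\<close>
      have "w t < sum w {m, v}" using max[OF t(1)] pos[OF v(1)] v(2) by simp
      from two_point_less[OF assms(1,2) pos[OF t(1)] this]
      have "excess \<alpha> w m {m, v} < excess \<alpha> w m (insert t {m, v})"
        using t by (subst excess_insert) auto
      moreover have "excess \<alpha> w m {m, v} = 0"
        using pair[OF v(2)] two_point_eq[OF assms(2) \<open>w m > 0\<close>] eq by simp
      ultimately show False using mono[of "insert t {m, v}"] v t assms(3) zero by simp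
    qed
    with v(2) eq show ?thesis by blast
  qed simp
qed

section \<open>Arrangements by weight and removal of the heaviest elements\<close>

text \<open>A heaviest remaining element is picked repeatedly. For finite \<open>F\<close> counting
  shows that all are reached; for infinite \<open>F\<close> an element never picked would be
  outweighed or matched by infinitely many picks, against \<open>finite_weight_ge\<close>.\<close>

lemma nonincreasing_arrangement_exists:
  fixes w :: "'a \<Rightarrow> real"
  assumes sm: "w summable_on F" and pos: "\<And>u. u \<in> F \<Longrightarrow> w u > 0"
  shows "\<exists>e. nonincreasing_arrangement w F e"
proof -
  define pick where "pick S = (SOME m. m \<in> S \<and> (\<forall>u\<in>S. w u \<le> w m))" for S
  have pick: "pick S \<in> S \<and> (\<forall>u\<in>S. w u \<le> w (pick S))" if "S \<subseteq> F" "S \<noteq> {}" for S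
  proof -
    have "w summable_on S" using sm that(1) by (rule summable_on_subset_banach)
    moreover have "w u > 0" if "u \<in> S" for u using that \<open>S \<subseteq> F\<close> by (intro pos) auto
    ultimately have "\<exists>m\<in>S. \<forall>u\<in>S. w u \<le> w m"
      using \<open>S \<noteq> {}\<close> by (rule exists_heaviest)
    then show ?thesis unfolding pick_def Bex_def by (rule someI_ex)
  qed
  \<comment> \<open>\<open>S n\<close> is what remains after \<open>n\<close> picks; the shift in
    \<open>e\<close> is there because ranks start at 1.\<close>
  define S where "S = rec_nat F (\<lambda>_ X. X - {pick X})"
  define e where "e j = pick (S (j - 1))" for j
  have S0: "S 0 = F" and SSuc: "S (Suc n) = S n - {pick (S n)}" for n
    by (simp_all add: S_def)
  have dec: "S j \<subseteq> S i" if "i \<le> j" for i j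
    using that by (induction rule: dec_induct) (auto simp: SSuc)
  have sub: "S n \<subseteq> F" for n using dec[of 0 n] S0 by simp
  have S_eq: "S n = F - e ` {1..n}" for n
  proof (induction n)
    case (Suc n)
    have "{1..Suc n} = insert (Suc n) {1..n}" by auto
    then show ?case using Suc by (auto simp: SSuc e_def)
  qed (simp add: S0)
  have ne: "S (j - 1) \<noteq> {}" if "j \<in> ranks F" for j
  proof
    assume "S (j - 1) = {}"
    then have "F \<subseteq> e ` {1..j - 1}" using S_eq by auto
    then have "finite F" "card F \<le> j - 1"
      using finite_subset card_mono[of "e ` {1..j - 1}" F] card_image_le[of "{1..j - 1}" e] by auto
    then show False using that by (auto simp: ranks_def)
  qed
  have eS: "e j \<in> S (j - 1)" and emax: "\<And>u. u \<in> S (j - 1) \<Longrightarrow> w u \<le> w (e j)"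
    if "j \<in> ranks F" for j
    using pick[OF sub ne[OF that]] by (auto simp: e_def)
  have neq: "e i \<noteq> e j" if "j \<in> ranks F" "1 \<le> i" "i < j" for i j
  proof -
    have "e i \<in> e ` {1..j - 1}" using that(2,3) by (intro imageI) auto
    then show ?thesis using eS[OF that(1)] unfolding S_eq by auto
  qed
  have inj: "inj_on e (ranks F)"
  proof (rule inj_onI)
    fix i j assume "i \<in> ranks F" "j \<in> ranks F" "e i = e j"
    then show "i = j" using neq[of i j] neq[of j i] by (cases i j rule: linorder_cases) (auto simp: ranks_def)
  qed
  have im: "e ` ranks F \<subseteq> F" using eS sub by blast
  have "F \<subseteq> e ` ranks F"
  proof (cases "finite F")
    case True
    then have "ranks F = {1..card F}" by (auto simp: ranks_def)
    then have "card (e ` ranks F) = card F" using card_image[OF inj] by simp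
    then show ?thesis using card_subset_eq[OF True im] by simp
  next
    case False
    show ?thesis
    proof
      fix u assume u: "u \<in> F"
      show "u \<in> e ` ranks F"
      proof (rule ccontr)
        assume n: "u \<notin> e ` ranks F"
        have "w u \<le> w (e j)" if "j \<in> ranks F" for j
        proof (rule emax[OF that])
          show "u \<in> S (j - 1)" unfolding S_eq using u n False by (auto simp: ranks_def)
        qed
        then have "e ` ranks F \<subseteq> {v \<in> F. w u \<le> w v}" using im by auto
        moreover have "finite {v \<in> F. w u \<le> w v}"
          using pos u by (intro finite_weight_ge sm) (auto simp: less_imp_le)
        ultimately have "finite (e ` ranks F)" by (rule finite_subset)
        then have "finite (ranks F)" using inj by (simp add: finite_image_iff)
        moreover have "ranks F = {1..}" using False by (auto simp: ranks_def)
        ultimately show False by (simp add: infinite_Ici)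
      qed
    qed
  qed
  then have "bij_betw e (ranks F) F" using inj im by (auto simp: bij_betw_def)
  moreover have "w (e j) \<le> w (e i)" if "i \<in> ranks F" "j \<in> ranks F" "i \<le> j" for i j
    using eS[OF that(2)] dec[OF diff_le_mono[OF that(3)]] by (intro emax[OF that(1)]) blast
  ultimately show ?thesis unfolding nonincreasing_arrangement_def by blast
qed

text \<open>\<open>T\<close> collects the elements of rank at most \<open>g\<close>. This trades
  sums over ranks for sums over a complement, so later arguments need no arrangement.\<close>

lemma ordered_weight_tail:
  fixes w :: "'a \<Rightarrow> real"
  assumes sm: "w summable_on F" and pos: "\<And>u. u \<in> F \<Longrightarrow> w u > 0"
  obtains T where "T \<subseteq> F" "finite T" "T = F \<and> card T \<le> g \<or> card T = g"
    "\<forall>u\<in>F - T. \<forall>t\<in>T. w u \<le> w t"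
    "(\<Sum>\<^sub>\<infinity>j\<in>{j \<in> ranks F. j > g}. ordered_weight w F j powr \<alpha>) = (\<Sum>\<^sub>\<infinity>u\<in>F - T. w u powr \<alpha>)"
proof -
  \<comment> \<open>The same choice as in \<open>ordered_weight\<close>, so that the ordered weights
    are \<open>w (e j)\<close> by definition.\<close>
  define e where "e = (SOME e. nonincreasing_arrangement w F e)"
  have "nonincreasing_arrangement w F e"
    unfolding e_def using nonincreasing_arrangement_exists[OF assms] by (rule someI_ex)
  then have bij: "bij_betw e (ranks F) F"
    and mono: "\<And>i j. i \<in> ranks F \<Longrightarrow> j \<in> ranks F \<Longrightarrow> i \<le> j \<Longrightarrow> w (e j) \<le> w (e i)"
    by (auto simp: nonincreasing_arrangement_def)
  let ?R = "{j \<in> ranks F. j \<le> g}"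
  have R: "?R \<subseteq> {1..g}" by (auto simp: ranks_def)
  then have finR: "finite ?R" by (rule finite_subset) simp
  have inj: "inj_on e ?R" using bij by (auto simp: bij_betw_def intro: inj_on_subset)
  have diff: "F - e ` ?R = e ` {j \<in> ranks F. j > g}"
    using bij by (fastforce simp: bij_betw_def inj_on_def)
  show ?thesis
  proof (rule that[of "e ` ?R"])
    show "e ` ?R \<subseteq> F" using bij by (auto simp: bij_betw_def)
    show "finite (e ` ?R)" using finR by simp
    show "e ` ?R = F \<and> card (e ` ?R) \<le> g \<or> card (e ` ?R) = g"
    proof (cases "finite F \<and> card F \<le> g")
      case True
      then have "?R = ranks F" by (auto simp: ranks_def)
      then show ?thesis using True bij by (simp add: bij_betw_def)
    next
      case False
      then have "?R = {1..g}" by (auto simp: ranks_def)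
      then show ?thesis using card_image[OF inj] by simp
    qed
    show "\<forall>u\<in>F - e ` ?R. \<forall>t\<in>e ` ?R. w u \<le> w t"
      unfolding diff by (auto intro!: mono)
    have "bij_betw e {j \<in> ranks F. j > g} (F - e ` ?R)"
      unfolding diff using bij by (auto simp: bij_betw_def intro: inj_on_subset)
    from infsum_reindex_bij_betw[OF this, of "\<lambda>u. w u powr \<alpha>"]
    show "(\<Sum>\<^sub>\<infinity>j\<in>{j \<in> ranks F. j > g}. ordered_weight w F j powr \<alpha>) = (\<Sum>\<^sub>\<infinity>u\<in>F - e ` ?R. w u powr \<alpha>)"
      by (simp add: ordered_weight_def e_def)
  qed
qed

text \<open>Exchange argument: \<open>M - T\<close> injects into \<open>T - M\<close>, and each
  image is at least as heavy, so \<open>T\<close> carries at least the sum of \<open>M\<close>. If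
  \<open>T = F\<close>, nothing remains on the left.\<close>

lemma infsum_Diff_heaviest_le:
  fixes f :: "'a \<Rightarrow> real"
  assumes sm: "f summable_on F" and nn: "\<And>u. u \<in> F \<Longrightarrow> f u \<ge> 0"
    and T: "T \<subseteq> F" "finite T" "T = F \<or> card T = g"
    and top: "\<And>u t. u \<in> F - T \<Longrightarrow> t \<in> T \<Longrightarrow> f u \<le> f t"
    and M: "M \<subseteq> F" "finite M" "card M \<le> g"
  shows "infsum f (F - T) \<le> infsum f (F - M)"
proof (cases "T = F")
  case True
  then show ?thesis using nn by (auto intro!: infsum_nonneg)
next
  case False
  have "card (M - T) \<le> card (T - M)"
    using card_le_sym_Diff[OF M(2) T(2)] M(3) T(3) False by simp
  then obtain h where h: "h ` (M - T) \<subseteq> T - M" "inj_on h (M - T)"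
    using card_le_inj[of "M - T" "T - M"] M(2) T(2) by auto
  have "sum f (M - T) \<le> sum (f \<circ> h) (M - T)"
    using h(1) M(1) by (intro sum_mono) (auto intro!: top)
  also have "\<dots> = sum f (h ` (M - T))" using h(2) by (simp add: sum.reindex)
  also have "\<dots> \<le> sum f (T - M)"
    using h(1) T nn by (intro sum_mono2) auto
  finally have "sum f M \<le> sum f T"
    using sum.Int_Diff[OF M(2), of f T] sum.Int_Diff[OF T(2), of f M] by (simp add: Int_commute)
  moreover have "infsum f (F - B) = infsum f F - sum f B" if "B \<subseteq> F" "finite B" for B
    using infsum_Diff[OF sm, of B] that by simp
  ultimately show ?thesis using T(1,2) M(1,2) by simp
qed

section \<open>The inequality inside one fibre\<close>

text \<open>The slack of the inequality on one fibre, with \<open>sgn (1 - \<alpha>)\<close> in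
  place of the absolute value so that it adds up over fibres.\<close>

definition fibre_gap :: "real \<Rightarrow> nat \<Rightarrow> ('a \<Rightarrow> real) \<Rightarrow> ('a \<Rightarrow> nat) \<Rightarrow> 'a set \<Rightarrow> real" where
  "fibre_gap \<alpha> g w lab F =
     sgn (1 - \<alpha>) * ((\<Sum>\<^sub>\<infinity>u\<in>F. w u powr \<alpha>)
       - (\<Sum>c\<in>{1..g}. (\<Sum>\<^sub>\<infinity>u\<in>{u \<in> F. lab u = c}. w u) powr \<alpha>))
     - d_const \<alpha> * (\<Sum>\<^sub>\<infinity>j\<in>{j \<in> ranks F. j > g}. ordered_weight w F j powr \<alpha>)"

text \<open>The class excesses add up to this gap, except that the tail is replaced by the sum off
  the heaviest class elements; that sum is at least the tail.\<close>

lemma fibre_gap_nonneg: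
  fixes w :: "'a \<Rightarrow> real"
  assumes \<alpha>: "\<alpha> > 0" "\<alpha> \<noteq> 1"
    and sm: "w summable_on F" and sma: "(\<lambda>u. w u powr \<alpha>) summable_on F"
    and pos: "\<And>u. u \<in> F \<Longrightarrow> w u > 0" and lab: "lab ` F \<subseteq> {1..g}"
  shows "0 \<le> fibre_gap \<alpha> g w lab F"
proof -
  let ?f = "\<lambda>u. w u powr \<alpha>"
  define K where "K c = {u \<in> F. lab u = c}" for c
  \<comment> \<open>Empty classes have no heaviest element and contribute 0 to both sums.\<close>
  define C where "C = {c \<in> {1..g}. K c \<noteq> {}}"
  have smK: "w summable_on K c" "?f summable_on K c" for c
    using sm sma by (auto simp: K_def intro: summable_on_subset_banach)
  have "\<exists>m. m \<in> K c \<and> (\<forall>u\<in>K c. w u \<le> w m)" if "c \<in> C" for c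
  proof -
    have "K c \<noteq> {}" using that by (simp add: C_def)
    then have "\<exists>m\<in>K c. \<forall>u\<in>K c. w u \<le> w m"
      by (intro exists_heaviest smK) (auto simp: K_def pos)
    then show ?thesis by blast
  qed
  then obtain m where m: "\<And>c. c \<in> C \<Longrightarrow> m c \<in> K c"
    and max: "\<And>c u. c \<in> C \<Longrightarrow> u \<in> K c \<Longrightarrow> w u \<le> w (m c)" by metis
  have C: "C \<subseteq> {1..g}" "finite C" by (auto simp: C_def)
  \<comment> \<open>The label recovers the class from its heaviest element.\<close>
  have inj: "inj_on m C" using m by (intro inj_on_inverseI[of _ lab]) (auto simp: K_def)
  obtain T where T: "T \<subseteq> F" "finite T" "T = F \<and> card T \<le> g \<or> card T = g"
    "\<forall>u\<in>F - T. \<forall>t\<in>T. w u \<le> w t"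
    "(\<Sum>\<^sub>\<infinity>j\<in>{j \<in> ranks F. j > g}. ordered_weight w F j powr \<alpha>) = infsum ?f (F - T)"
    by (rule ordered_weight_tail[OF sm pos, of g \<alpha>])
  have mF: "m ` C \<subseteq> F" using m by (auto simp: K_def)
  have "infsum ?f (F - T) \<le> infsum ?f (F - m ` C)"
  proof (rule infsum_Diff_heaviest_le[OF sma _ T(1,2)])
    show "card (m ` C) \<le> g" using card_mono[OF _ C(1)] card_image[OF inj] by simp
    show "?f u \<le> ?f t" if "u \<in> F - T" "t \<in> T" for u t
      using T(4) that pos \<alpha>(1) by (intro powr_mono2) (auto simp: less_imp_le)
  qed (use T(3) C(2) mF in auto)
  also have "\<dots> = infsum ?f F - sum ?f (m ` C)"
    using infsum_Diff[OF sma _ mF] C(2) by simp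
  also have "sum ?f (m ` C) = (\<Sum>c\<in>C. ?f (m c))" using inj by (simp add: sum.reindex)
  finally have tail: "infsum ?f (F - T) \<le> infsum ?f F - (\<Sum>c\<in>C. ?f (m c))" .
  have total: "infsum ?f F = (\<Sum>c\<in>C. infsum ?f (K c))"
  proof -
    have "infsum ?f F = (\<Sum>c\<in>{1..g}. infsum ?f (K c))"
      using infsum_fibres(2)[OF sma lab] by (simp add: K_def)
    also have "\<dots> = (\<Sum>c\<in>C. infsum ?f (K c))"
      using C by (intro sum.mono_neutral_right) (auto simp: C_def)
    finally show ?thesis .
  qed
  have classes: "(\<Sum>c\<in>{1..g}. infsum w (K c) powr \<alpha>) = (\<Sum>c\<in>C. infsum w (K c) powr \<alpha>)"
    using C by (intro sum.mono_neutral_right) (auto simp: C_def)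
  have "0 \<le> (\<Sum>c\<in>C. excess \<alpha> w (m c) (K c))"
    using m max pos by (intro sum_nonneg excess_nonneg \<alpha> smK) (auto simp: K_def)
  also have "\<dots> = sgn (1 - \<alpha>) * (infsum ?f F - (\<Sum>c\<in>C. infsum w (K c) powr \<alpha>))
      - d_const \<alpha> * (infsum ?f F - (\<Sum>c\<in>C. ?f (m c)))"
    unfolding total excess_def by (simp add: sum_subtractf sum_distrib_left right_diff_distrib)
  also have "\<dots> \<le> sgn (1 - \<alpha>) * (infsum ?f F - (\<Sum>c\<in>C. infsum w (K c) powr \<alpha>))
      - d_const \<alpha> * infsum ?f (F - T)"
    using tail by (intro diff_left_mono mult_left_mono) (auto simp: d_const_def)
  also have "\<dots> = fibre_gap \<alpha> g w lab F"
    unfolding fibre_gap_def T(5) classes[symmetric] by (simp add: K_def)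
  finally show ?thesis .
qed

text \<open>With one label the fibre is a single class and \<open>T\<close> is one heaviest element,
  so the comparison of tails loses nothing and equality can be read off from the excess.\<close>

lemma fibre_gap_one:
  fixes w :: "'a \<Rightarrow> real"
  assumes sm: "w summable_on F" and sma: "(\<lambda>u. w u powr \<alpha>) summable_on F"
    and pos: "\<And>u. u \<in> F \<Longrightarrow> w u > 0" and lab: "lab ` F \<subseteq> {1}" and "F \<noteq> {}"
  obtains m where "m \<in> F" "\<forall>u\<in>F. w u \<le> w m" "fibre_gap \<alpha> 1 w lab F = excess \<alpha> w m F"
proof -
  let ?f = "\<lambda>u. w u powr \<alpha>"
  obtain T where T: "T \<subseteq> F" "finite T" "T = F \<and> card T \<le> 1 \<or> card T = 1"
    "\<forall>u\<in>F - T. \<forall>t\<in>T. w u \<le> w t"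
    "(\<Sum>\<^sub>\<infinity>j\<in>{j \<in> ranks F. j > 1}. ordered_weight w F j powr \<alpha>) = infsum ?f (F - T)"
    by (rule ordered_weight_tail[OF sm pos, of 1 \<alpha>])
  have "card T = 1" using T(1-3) \<open>F \<noteq> {}\<close> by (metis One_nat_def Suc_leI card_gt_0_iff le_antisym)
  then obtain m where m: "T = {m}" by (rule card_1_singletonE)
  have "infsum ?f (F - T) = infsum ?f F - ?f m"
    using infsum_Diff[OF sma _ T(1)] m by simp
  moreover have "{u \<in> F. lab u = 1} = F" using lab by auto
  ultimately have "fibre_gap \<alpha> 1 w lab F = excess \<alpha> w m F"
    unfolding fibre_gap_def T(5) by (simp add: excess_def)
  moreover have "m \<in> F" "\<forall>u\<in>F. w u \<le> w m" using T(1,4) m by auto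
  ultimately show ?thesis using that by blast
qed

lemma fibre_gap_one_eq_0_iff:
  fixes w :: "'a \<Rightarrow> real"
  assumes \<alpha>: "\<alpha> > 0" "\<alpha> \<noteq> 1"
    and sm: "w summable_on F" and sma: "(\<lambda>u. w u powr \<alpha>) summable_on F"
    and pos: "\<And>u. u \<in> F \<Longrightarrow> w u > 0" and lab: "lab ` F \<subseteq> {1}" and "F \<noteq> {}"
  shows "fibre_gap \<alpha> 1 w lab F = 0 \<longleftrightarrow>
    (\<not> is_singleton F \<longrightarrow> (\<exists>u v. u \<noteq> v \<and> F = {u, v} \<and> w u = w v))"
proof -
  obtain m where m: "m \<in> F" "\<forall>u\<in>F. w u \<le> w m"
    and "fibre_gap \<alpha> 1 w lab F = excess \<alpha> w m F"
    by (rule fibre_gap_one[OF sm sma pos lab \<open>F \<noteq> {}\<close>])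
  then have eq: "fibre_gap \<alpha> 1 w lab F = 0 \<longleftrightarrow>
      F = {m} \<or> (\<exists>v. v \<noteq> m \<and> F = {m, v} \<and> w v = w m)"
    using excess_eq_0_iff[OF \<alpha> m(1) pos _ sm sma] m(2) by simp
  have single: "is_singleton F \<longleftrightarrow> F = {m}"
    using m(1) by (auto simp: is_singleton_def)
  \<comment> \<open>The heaviest \<open>m\<close> may be either member of an equal pair.\<close>
  have "(\<exists>u v. u \<noteq> v \<and> F = {u, v} \<and> w u = w v) \<longleftrightarrow> (\<exists>v. v \<noteq> m \<and> F = {m, v} \<and> w v = w m)"
  proof
    assume "\<exists>u v. u \<noteq> v \<and> F = {u, v} \<and> w u = w v"
    then obtain u v where uv: "u \<noteq> v" "F = {u, v}" "w u = w v" by blast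
    then consider "m = u" | "m = v" using m(1) by blast
    then show "\<exists>v. v \<noteq> m \<and> F = {m, v} \<and> w v = w m"
    proof cases
      case 1
      then show ?thesis using uv by (intro exI[of _ v]) auto
    next
      case 2
      then show ?thesis using uv by (intro exI[of _ u]) auto
    qed
  next
    assume "\<exists>v. v \<noteq> m \<and> F = {m, v} \<and> w v = w m"
    then show "\<exists>u v. u \<noteq> v \<and> F = {u, v} \<and> w u = w v" by metis
  qed
  then show ?thesis using eq single by blast
qed

section \<open>Summation over all fibres\<close>

text \<open>For \<open>\<alpha> < 1\<close> nonnegative excess bounds the power of a class sum by
  the sum of powers. For \<open>\<alpha> > 1\<close> one factor of the class sum is kept and the
  remaining power is bounded by that of the total weight.\<close>

lemma class_powr_summable:
  fixes w :: "'a \<Rightarrow> real"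
  assumes \<alpha>: "\<alpha> > 0" "\<alpha> \<noteq> 1"
    and sm: "w summable_on W" and sma: "(\<lambda>u. w u powr \<alpha>) summable_on W"
    and pos: "\<And>u. u \<in> W \<Longrightarrow> w u > 0" and \<kappa>: "\<kappa> ` W \<subseteq> I"
  shows "(\<lambda>i. (\<Sum>\<^sub>\<infinity>u\<in>{u \<in> W. \<kappa> u = i}. w u) powr \<alpha>) summable_on I"
proof -
  let ?K = "\<lambda>i. {u \<in> W. \<kappa> u = i}" and ?f = "\<lambda>u. w u powr \<alpha>"
  have smK: "w summable_on ?K i" "?f summable_on ?K i" for i
    using sm sma by (auto intro: summable_on_subset_banach)
  show ?thesis
  proof (cases "\<alpha> < 1")
    case True
    have "infsum w (?K i) powr \<alpha> \<le> infsum ?f (?K i)" for i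
    proof (cases "?K i = {}")
      case False
      then have "\<exists>m\<in>?K i. \<forall>u\<in>?K i. w u \<le> w m"
        by (intro exists_heaviest smK) (auto simp: pos)
      then obtain m where m: "m \<in> ?K i" "\<And>u. u \<in> ?K i \<Longrightarrow> w u \<le> w m" by blast
      have "0 \<le> excess \<alpha> w m (?K i)"
        using m pos by (intro excess_nonneg \<alpha> smK) auto
      moreover have "0 \<le> d_const \<alpha> * (infsum ?f (?K i) - ?f m)"
        using finite_sum_le_infsum[OF smK(2), of "{m}"] m(1)
        by (intro mult_nonneg_nonneg) (auto simp: d_const_def)
      ultimately show ?thesis using True by (simp add: excess_def)
    next
      case True
      show ?thesis unfolding True by simp
    qed
    then show ?thesis
      by (intro summable_on_comparison_test[OF infsum_fibres(1)[OF sma \<kappa>]]) auto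
  next
    case False
    have "infsum w (?K i) powr \<alpha> \<le> infsum w W powr (\<alpha> - 1) * infsum w (?K i)" for i
    proof -
      have nn: "0 \<le> infsum w (?K i)" by (intro infsum_nonneg) (auto simp: pos less_imp_le)
      have "infsum w (?K i) \<le> infsum w W"
        by (intro infsum_mono2 sm smK) (auto simp: pos less_imp_le)
      then have "infsum w (?K i) powr (\<alpha> - 1) * infsum w (?K i)
          \<le> infsum w W powr (\<alpha> - 1) * infsum w (?K i)"
        using nn False by (intro mult_right_mono powr_mono2) auto
      moreover have "infsum w (?K i) powr (\<alpha> - 1) * infsum w (?K i) = infsum w (?K i) powr \<alpha>"
        using nn powr_add[of "infsum w (?K i)" "\<alpha> - 1" 1] by (cases "infsum w (?K i) = 0") auto
      ultimately show ?thesis by simp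
    qed
    then show ?thesis
      by (intro summable_on_comparison_test[OF summable_on_cmult_right[OF infsum_fibres(1)[OF sm \<kappa>]]]) auto
  qed
qed

text \<open>The inequality becomes an identity with a nonnegative remainder, which serves both the
  bound and the equality case.\<close>

lemma merging_defect_eq:
  fixes w :: "'a \<Rightarrow> real" and \<pi> :: "'a \<Rightarrow> 'b"
  assumes \<alpha>: "\<alpha> > 0" "\<alpha> \<noteq> 1" and adm: "admissible_family \<alpha> W w" and lab: "lab \<in> W \<rightarrow> {1..g}"
  shows "(\<lambda>z. fibre_gap \<alpha> g w lab (fibre W \<pi> z)) summable_on \<pi> ` W"
    and "z \<in> \<pi> ` W \<Longrightarrow> 0 \<le> fibre_gap \<alpha> g w lab (fibre W \<pi> z)"
    and "merging_defect \<alpha> g W w \<pi> lab = d_const \<alpha> * tail_sum \<alpha> g W w \<pi>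
      + (\<Sum>\<^sub>\<infinity>z\<in>\<pi> ` W. fibre_gap \<alpha> g w lab (fibre W \<pi> z))"
proof -
  let ?f = "\<lambda>u. w u powr \<alpha>" and ?F = "fibre W \<pi>" and ?s = "sgn (1 - \<alpha>)"
  have pos: "\<And>u. u \<in> W \<Longrightarrow> w u > 0" and sm: "w summable_on W" and sma: "?f summable_on W"
    using adm by (auto simp: admissible_family_def)
  have smF: "w summable_on ?F z" "?f summable_on ?F z" for z
    using sm sma by (auto simp: fibre_def intro: summable_on_subset_banach)
  have posF: "w u > 0" if "u \<in> ?F z" for u z using that pos by (simp add: fibre_def)
  define \<phi> where "\<phi> z = infsum ?f (?F z)" for z
  define \<psi> where "\<psi> z = (\<Sum>c\<in>{1..g}. (\<Sum>\<^sub>\<infinity>u\<in>{u \<in> ?F z. lab u = c}. w u) powr \<alpha>)" for z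
  define \<tau> where "\<tau> z = (\<Sum>\<^sub>\<infinity>j\<in>{j \<in> ranks (?F z). j > g}. ordered_weight w (?F z) j powr \<alpha>)" for z
  have gap: "fibre_gap \<alpha> g w lab (?F z) = ?s * (\<phi> z - \<psi> z) - d_const \<alpha> * \<tau> z" for z
    by (simp add: fibre_gap_def \<phi>_def \<psi>_def \<tau>_def)
  have gap_nonneg: "0 \<le> fibre_gap \<alpha> g w lab (?F z)" for z
    using lab by (intro fibre_gap_nonneg \<alpha> smF posF) (auto simp: fibre_def)
  then show "0 \<le> fibre_gap \<alpha> g w lab (?F z)" .

  have \<phi>: "\<phi> summable_on \<pi> ` W" "infsum \<phi> (\<pi> ` W) = infsum ?f W"
    using infsum_fibres[OF sma order_refl, of \<pi>] unfolding \<phi>_def fibre_def by auto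

  \<comment> \<open>Classes are indexed by the joint map \<open>(\<pi> u, lab u)\<close>.\<close>
  have "(\<lambda>i. (\<Sum>\<^sub>\<infinity>u\<in>{u \<in> W. (\<pi> u, lab u) = i}. w u) powr \<alpha>) summable_on \<pi> ` W \<times> {1..g}"
    using lab by (intro class_powr_summable \<alpha> sm sma pos) auto
  then have cls: "(\<lambda>(z, c). (\<Sum>\<^sub>\<infinity>u\<in>{u \<in> W. \<pi> u = z \<and> lab u = c}. w u) powr \<alpha>)
      summable_on \<pi> ` W \<times> {1..g}"
    by (rule back_subst[where P = "\<lambda>f. f summable_on _"]) auto
  have \<psi>_eq: "\<psi> = (\<lambda>z. \<Sum>\<^sub>\<infinity>c\<in>{1..g}. (\<Sum>\<^sub>\<infinity>u\<in>{u \<in> W. \<pi> u = z \<and> lab u = c}. w u) powr \<alpha>)"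
    by (auto simp: \<psi>_def fibre_def conj_assoc)
  have \<psi>: "\<psi> summable_on \<pi> ` W"
    "infsum \<psi> (\<pi> ` W) = (\<Sum>\<^sub>\<infinity>(z, c)\<in>\<pi> ` W \<times> {1..g}.
       (\<Sum>\<^sub>\<infinity>u\<in>{u \<in> W. \<pi> u = z \<and> lab u = c}. w u) powr \<alpha>)"
    unfolding \<psi>_eq using summable_on_Sigma_banach[OF cls] infsum_Sigma'_banach[OF cls] by auto

  \<comment> \<open>Each tail is a sum over part of the fibre, so the tails are summable by
    comparison with \<open>\<phi>\<close>.\<close>
  have "\<tau> z \<le> \<phi> z" for z
  proof -
    obtain T where T: "\<tau> z = infsum ?f (?F z - T)"
      unfolding \<tau>_def by (rule ordered_weight_tail[OF smF(1) posF, where g = g and \<alpha> = \<alpha>])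
    show ?thesis unfolding T \<phi>_def
      by (intro infsum_mono2 smF summable_on_subset_banach[OF smF(2)]) auto
  qed
  moreover have \<tau>_nonneg: "0 \<le> \<tau> z" for z unfolding \<tau>_def by (intro infsum_nonneg) auto
  ultimately have \<tau>: "\<tau> summable_on \<pi> ` W"
    by (intro summable_on_comparison_test[OF \<phi>(1)]) auto
  have tail: "tail_sum \<alpha> g W w \<pi> = infsum \<tau> (\<pi> ` W)"
    by (simp add: tail_sum_def \<tau>_def[abs_def])

  have hs: "((\<lambda>z. fibre_gap \<alpha> g w lab (?F z)) has_sum
      ?s * (infsum \<phi> (\<pi> ` W) - infsum \<psi> (\<pi> ` W)) - d_const \<alpha> * infsum \<tau> (\<pi> ` W)) (\<pi> ` W)"
    unfolding gap by (intro has_sum_diff has_sum_cmult_right has_sum_infsum \<phi> \<psi> \<tau>)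
  then show "(\<lambda>z. fibre_gap \<alpha> g w lab (?F z)) summable_on \<pi> ` W"
    by (rule has_sum_imp_summable)
  have sum_gap: "(\<Sum>\<^sub>\<infinity>z\<in>\<pi> ` W. fibre_gap \<alpha> g w lab (?F z)) =
      ?s * (infsum \<phi> (\<pi> ` W) - infsum \<psi> (\<pi> ` W)) - d_const \<alpha> * tail_sum \<alpha> g W w \<pi>"
    unfolding tail using hs by (rule infsumI)
  \<comment> \<open>The signed defect is the total gap plus a nonnegative tail term, hence
    nonnegative and equal to its absolute value.\<close>
  have "0 \<le> (\<Sum>\<^sub>\<infinity>z\<in>\<pi> ` W. fibre_gap \<alpha> g w lab (?F z))"
    using gap_nonneg by (intro infsum_nonneg)
  moreover have "0 \<le> d_const \<alpha> * tail_sum \<alpha> g W w \<pi>"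
    unfolding tail using \<tau>_nonneg by (intro mult_nonneg_nonneg infsum_nonneg) (auto simp: d_const_def)
  ultimately have "0 \<le> ?s * (infsum \<phi> (\<pi> ` W) - infsum \<psi> (\<pi> ` W))"
    unfolding sum_gap by simp
  then have "\<bar>infsum \<phi> (\<pi> ` W) - infsum \<psi> (\<pi> ` W)\<bar> = ?s * (infsum \<phi> (\<pi> ` W) - infsum \<psi> (\<pi> ` W))"
    using \<alpha>(2) by (auto simp: sgn_if split: if_splits)
  then show "merging_defect \<alpha> g W w \<pi> lab = d_const \<alpha> * tail_sum \<alpha> g W w \<pi>
      + (\<Sum>\<^sub>\<infinity>z\<in>\<pi> ` W. fibre_gap \<alpha> g w lab (?F z))"
    unfolding sum_gap merging_defect_def \<phi>(2)[symmetric] \<psi>(2)[symmetric] by simp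
qed

section \<open>Sharpness and the theorem\<close>

text \<open>The label \<open>max 1 u\<close> joins 0 and 1 and leaves every other element alone. The
  defect is the absolute value of \<open>(g + 1) - (2 powr \<alpha> + (g - 1))\<close>, and only
  rank \<open>g + 1\<close> enters the tail.\<close>

lemma equal_weights_sharp:
  assumes "g \<ge> 1"
  defines "lab \<equiv> \<lambda>u. max 1 u"
  shows "admissible_family \<alpha> {0..g} (\<lambda>_. 1)" "lab \<in> {0..g} \<rightarrow> {1..g}"
    "merging_defect \<alpha> g {0..g} (\<lambda>_. 1) (\<lambda>_. 0 :: nat) lab = d_const \<alpha>"
    "tail_sum \<alpha> g {0..g} (\<lambda>_. 1) (\<lambda>_. 0 :: nat) = 1"
proof -
  show "admissible_family \<alpha> {0..g} (\<lambda>_. 1)" by (simp add: admissible_family_def)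
  show "lab \<in> {0..g} \<rightarrow> {1..g}" using assms by auto
  have "(\<Sum>\<^sub>\<infinity>u\<in>{u \<in> {0..g}. (0::nat) = 0 \<and> lab u = c}. 1) powr \<alpha> = (if c = 1 then 2 powr \<alpha> else 1)"
    if "c \<in> {1..g}" for c
  proof (cases "c = 1")
    case True
    then have "{u \<in> {0..g}. (0::nat) = 0 \<and> lab u = c} = {0, 1}" using assms by (auto simp: max_def)
    then show ?thesis using True by simp
  next
    case False
    then have "{u \<in> {0..g}. (0::nat) = 0 \<and> lab u = c} = {c}" using that by (auto simp: lab_def max_def)
    then show ?thesis using False by simp
  qed
  then have "(\<Sum>c\<in>{1..g}. (\<Sum>\<^sub>\<infinity>u\<in>{u \<in> {0..g}. (0::nat) = 0 \<and> lab u = c}. 1) powr \<alpha>)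
      = (\<Sum>c\<in>{1..g}. if c = 1 then 2 powr \<alpha> else 1)"
    by (rule sum.cong[OF refl])
  also have "\<dots> = 2 powr \<alpha> + (\<Sum>c\<in>{1..g} - {1}. 1)"
    using assms(1) by (subst sum.remove[of _ 1]) (auto intro!: sum.cong)
  finally have "(\<Sum>c\<in>{1..g}. (\<Sum>\<^sub>\<infinity>u\<in>{u \<in> {0..g}. (0::nat) = 0 \<and> lab u = c}. 1) powr \<alpha>)
      = 2 powr \<alpha> + (real g - 1)"
    using assms(1) by (simp add: of_nat_diff)
  moreover have "(\<Sum>\<^sub>\<infinity>(z, c)\<in>(\<lambda>_. 0 :: nat) ` {0..g} \<times> {1..g}.
       (\<Sum>\<^sub>\<infinity>u\<in>{u \<in> {0..g}. 0 = z \<and> lab u = c}. 1) powr \<alpha>)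
     = (\<Sum>c\<in>{1..g}. (\<Sum>\<^sub>\<infinity>u\<in>{u \<in> {0..g}. (0::nat) = 0 \<and> lab u = c}. 1) powr \<alpha>)"
  proof -
    have "(\<lambda>_. 0 :: nat) ` {0..g} = {0}" by auto
    then show ?thesis by (simp add: sum.cartesian_product[symmetric])
  qed
  ultimately show "merging_defect \<alpha> g {0..g} (\<lambda>_. 1) (\<lambda>_. 0 :: nat) lab = d_const \<alpha>"
    unfolding merging_defect_def by (simp add: d_const_def)
  have im: "(\<lambda>_. 0 :: nat) ` {0..g} = {0}" by auto
  have "fibre {0..g} (\<lambda>_. 0 :: nat) 0 = {0..g}" by (auto simp: fibre_def)
  moreover have "{j \<in> ranks {0..g}. j > g} = {Suc g}" by (auto simp: ranks_def)
  \<comment> \<open>Constant weights make \<open>ordered_weight\<close> equal to 1 whatever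
    arrangement is chosen.\<close>
  ultimately show "tail_sum \<alpha> g {0..g} (\<lambda>_. 1) (\<lambda>_. 0 :: nat) = 1"
    unfolding tail_sum_def im by (simp add: ordered_weight_def)
qed

theorem theorem1p7:
  fixes \<alpha> :: real and g :: nat
  assumes "g \<ge> 1" and "\<alpha> > 0" and "\<alpha> \<noteq> 1"
  shows
    "(\<forall>(W :: 'w set) (w :: 'w \<Rightarrow> real) (\<pi> :: 'w \<Rightarrow> 'z) (lab :: 'w \<Rightarrow> nat).
        admissible_family \<alpha> W w \<longrightarrow> lab \<in> W \<rightarrow> {1..g} \<longrightarrow>
        merging_defect \<alpha> g W w \<pi> lab \<ge> d_const \<alpha> * tail_sum \<alpha> g W w \<pi>)
     \<and>
     (\<forall>C > d_const \<alpha>.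
        \<not> (\<forall>(W :: nat set) (w :: nat \<Rightarrow> real) (\<pi> :: nat \<Rightarrow> nat) (lab :: nat \<Rightarrow> nat).
             admissible_family \<alpha> W w \<longrightarrow> lab \<in> W \<rightarrow> {1..g} \<longrightarrow>
             merging_defect \<alpha> g W w \<pi> lab \<ge> C * tail_sum \<alpha> g W w \<pi>))
     \<and>
     (g = 1 \<longrightarrow>
        (\<forall>(W :: 'w set) (w :: 'w \<Rightarrow> real) (\<pi> :: 'w \<Rightarrow> 'z) (lab :: 'w \<Rightarrow> nat).
           admissible_family \<alpha> W w \<longrightarrow> lab \<in> W \<rightarrow> {1..g} \<longrightarrow>
           (merging_defect \<alpha> g W w \<pi> lab = d_const \<alpha> * tail_sum \<alpha> g W w \<pi> \<longleftrightarrow>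
            (\<forall>z \<in> \<pi> ` W. \<not> is_singleton (fibre W \<pi> z) \<longrightarrow>
               (\<exists>u v. u \<noteq> v \<and> fibre W \<pi> z = {u, v} \<and> w u = w v)))))"
proof (intro conjI allI impI)
  fix W :: "'w set" and w :: "'w \<Rightarrow> real" and \<pi> :: "'w \<Rightarrow> 'z" and lab :: "'w \<Rightarrow> nat"
  assume "admissible_family \<alpha> W w" "lab \<in> W \<rightarrow> {1..g}"
  note eq = merging_defect_eq[OF assms(2,3) this, where \<pi> = \<pi>]
  have "0 \<le> (\<Sum>\<^sub>\<infinity>z\<in>\<pi> ` W. fibre_gap \<alpha> g w lab (fibre W \<pi> z))"
    using eq(2) by (rule infsum_nonneg)
  then show "merging_defect \<alpha> g W w \<pi> lab \<ge> d_const \<alpha> * tail_sum \<alpha> g W w \<pi>"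
    unfolding eq(3) by simp
next
  fix C assume "C > d_const \<alpha>"
  then show "\<not> (\<forall>(W :: nat set) (w :: nat \<Rightarrow> real) (\<pi> :: nat \<Rightarrow> nat) (lab :: nat \<Rightarrow> nat).
             admissible_family \<alpha> W w \<longrightarrow> lab \<in> W \<rightarrow> {1..g} \<longrightarrow>
             merging_defect \<alpha> g W w \<pi> lab \<ge> C * tail_sum \<alpha> g W w \<pi>)"
    \<comment> \<open>As the witness has tail sum 1, the inequality with \<open>C\<close> would give
      \<open>C \<le> d_const \<alpha>\<close>.\<close>
    using equal_weights_sharp[OF assms(1)] by (metis mult.right_neutral not_le)
next
  fix W :: "'w set" and w :: "'w \<Rightarrow> real" and \<pi> :: "'w \<Rightarrow> 'z" and lab :: "'w \<Rightarrow> nat"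
  assume "g = 1" and adm: "admissible_family \<alpha> W w" and lab: "lab \<in> W \<rightarrow> {1..g}"
  note eq = merging_defect_eq[OF assms(2,3) adm lab, where \<pi> = \<pi>]
  let ?G = "\<lambda>z. fibre_gap \<alpha> g w lab (fibre W \<pi> z)"
  have "merging_defect \<alpha> g W w \<pi> lab = d_const \<alpha> * tail_sum \<alpha> g W w \<pi> \<longleftrightarrow> infsum ?G (\<pi> ` W) = 0"
    unfolding eq(3) by simp
  \<comment> \<open>A summable nonnegative family with sum 0 vanishes termwise, so equality is
    decided fibre by fibre.\<close>
  also have "\<dots> \<longleftrightarrow> (\<forall>z\<in>\<pi> ` W. ?G z = 0)"
    using nonneg_infsum_le_0D[OF _ eq(1) eq(2)] by (auto intro: infsum_0)
  also have "\<dots> \<longleftrightarrow> (\<forall>z \<in> \<pi> ` W. \<not> is_singleton (fibre W \<pi> z) \<longrightarrow>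
               (\<exists>u v. u \<noteq> v \<and> fibre W \<pi> z = {u, v} \<and> w u = w v))"
  proof (rule ball_cong[OF refl])
    fix z assume z: "z \<in> \<pi> ` W"
    have sub: "fibre W \<pi> z \<subseteq> W" and ne: "fibre W \<pi> z \<noteq> {}" using z by (auto simp: fibre_def)
    have "w summable_on fibre W \<pi> z" "(\<lambda>u. w u powr \<alpha>) summable_on fibre W \<pi> z"
      using adm sub by (auto simp: admissible_family_def intro: summable_on_subset_banach)
    moreover have "w u > 0" if "u \<in> fibre W \<pi> z" for u
      using adm sub that by (auto simp: admissible_family_def)
    moreover have "lab ` fibre W \<pi> z \<subseteq> {1}" using lab sub \<open>g = 1\<close> by auto
    ultimately show "?G z = 0 \<longleftrightarrow> (\<not> is_singleton (fibre W \<pi> z) \<longrightarrow>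
               (\<exists>u v. u \<noteq> v \<and> fibre W \<pi> z = {u, v} \<and> w u = w v))"
      unfolding \<open>g = 1\<close> using ne by (rule fibre_gap_one_eq_0_iff[OF assms(2,3)])
  qed
  finally show "merging_defect \<alpha> g W w \<pi> lab = d_const \<alpha> * tail_sum \<alpha> g W w \<pi> \<longleftrightarrow>
      (\<forall>z \<in> \<pi> ` W. \<not> is_singleton (fibre W \<pi> z) \<longrightarrow>
               (\<exists>u v. u \<noteq> v \<and> fibre W \<pi> z = {u, v} \<and> w u = w v))" .
qed

end
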